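(* Let $d\in\mathbb{N}$, let $H$ be a finite-dimensional Hilbert space, and let $K:\mathbb{F}_d^+\times\mathbb{F}_d^+\to\mathcal{L}(H)$ be a moment kernel with $K(\emptyset,\emptyset)=I_H$ and $K^{(1)}:=K-\Sigma K\ge0$. For every integer $N\ge1$, $$K-\Sigma^NK=\sum_{n=0}^{N-1}\Sigma^nK^{(1)}.$$ Taking traces at $(\emptyset,\emptyset)$ and letting $N\to\infty$ yields the identity $$\kappa(K)=\mathrm{tr}(I_H)-\sum_{n=0}^\infty\mathrm{tr}\big((\Sigma^nK^{(1)})(\emptyset,\emptyset)\big),$$ and the series on the right converges in $[0,\mathrm{tr}(I_H)]$.
   Context: $\mathbb{F}_d^+$ is the free semigroup on $\{1,\dots,d\}$ with neutral element $\emptyset$. A moment kernel is a kernel $K(\alpha,\beta)=\mathbb{E}[A^\alpha(A^\beta)^*]$ for a $d$-tuple $A=(A_1,\dots,A_d)$ of strongly measurable random operators $A_i:\Omega\to\mathcal{L}(H)$ over a probability space with $\mathbb{E}[\|A^\alpha\|^2]<\infty$ for all $\alpha$, where $A^\alpha=A_{i_1}\cdots A_{i_k}$ for $\alpha=i_1\cdots i_k$ and $A^\emptyset=I$. A kernel $K$ is positive definite, written $K\ge0$, if $\sum_{i,j}\langle u_i,K(\alpha_i,\alpha_j)u_j\rangle\ge0$ for every finite family $\{(\alpha_j,u_j)\}\subset\mathbb{F}_d^+\times H$. The free shift is $(\Sigma K)(\alpha,\beta):=\sum_{i=1}^dK(\alpha i,\beta i)$. The curvature of $K$ is $\kappa(K):=\lim_{N\to\infty}\mathrm{tr}((\Sigma^NK)(\emptyset,\emptyset))$,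 the limit of a decreasing nonnegative sequence. *)

theory Defs
  imports
    "HOL-Probability.Probability"
    "HOL-Library.Complex_Order"
    "HOL-Library.Function_Algebras"
begin

text \<open>
  Finite-dimensional complex Hilbert spaces. This is the complex counterpart of the library class
  \<^class>\<open>euclidean_space\<close>: a fixed orthonormal basis is part of the class data. Unlike there, the
  basis may be empty, so the zero space is admitted. The inner product is antilinear in the first
  and linear in the second argument, and the norm and topology inherited from \<^class>\<open>real_inner\<close> are
  the ones it induces, since \<^term>\<open>inner\<close> is its real part. Completeness and second countability
  follow from finite dimension; they are superclasses so that the Bochner integral is available.
\<close>

class complex_euclidean = real_inner + complete_space + second_countable_topology +
  fixes scaleC :: "complex \<Rightarrow> 'a \<Rightarrow> 'a"
    and cinner :: "'a \<Rightarrow> 'a \<Rightarrow> complex"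
    and CBasis :: "'a set"
  assumes scaleC_of_real: "scaleC (complex_of_real r) x = r *\<^sub>R x"
    and scaleC_add_left: "scaleC (a + b) x = scaleC a x + scaleC b x"
    and scaleC_add_right: "scaleC a (x + y) = scaleC a x + scaleC a y"
    and scaleC_scaleC: "scaleC a (scaleC b x) = scaleC (a * b) x"
    and cinner_commute: "cinner x y = cnj (cinner y x)"
    and cinner_add_right: "cinner x (y + z) = cinner x y + cinner x z"
    and cinner_scaleC_right: "cinner x (scaleC a y) = a * cinner x y"
    and Re_cinner: "Re (cinner x y) = inner x y"
    and finite_CBasis: "finite CBasis"
    and cinner_CBasis:
      "\<lbrakk>u \<in> CBasis; v \<in> CBasis\<rbrakk> \<Longrightarrow> cinner u v = (if u = v then 1 else 0)"
    and cinner_all_zero_iff: "(\<forall>u\<in>CBasis. cinner u x = 0) \<longleftrightarrow> x = 0"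

instance complex_euclidean \<subseteq> banach ..

instantiation complex :: complex_euclidean
begin

definition scaleC_complex :: "complex \<Rightarrow> complex \<Rightarrow> complex"
  where "scaleC_complex a x = a * x"

definition cinner_complex :: "complex \<Rightarrow> complex \<Rightarrow> complex"
  where "cinner_complex x y = cnj x * y"

definition CBasis_complex :: "complex set"
  where "CBasis_complex = {1}"

instance
  by standard
    (auto simp: scaleC_complex_def cinner_complex_def CBasis_complex_def scaleR_conv_of_real
      algebra_simps inner_complex_def)

end

instantiation vec :: ("{complex_euclidean, euclidean_space}", finite) complex_euclidean
begin

definition scaleC_vec :: "complex \<Rightarrow> 'a ^ 'b \<Rightarrow> 'a ^ 'b"
  where "scaleC_vec a x = (\<chi> i. scaleC a (x $ i))"

definition cinner_vec :: "'a ^ 'b \<Rightarrow> 'a ^ 'b \<Rightarrow> complex"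
  where "cinner_vec x y = (\<Sum>i\<in>UNIV. cinner (x $ i) (y $ i))"

definition CBasis_vec :: "('a ^ 'b) set"
  where "CBasis_vec = (\<Union>i. \<Union>u\<in>CBasis. {axis i u})"

instance
proof
  have z: "cinner (0::'a) w = 0" "cinner w 0 = 0" for w :: 'a
    using cinner_scaleC_right[of w 0 0] cinner_commute[of 0 w] scaleC_of_real[of 0 "0::'a"]
    by auto
  have ax: "cinner (axis i u) x = cinner u (x $ i)" for i and u :: 'a and x :: "'a ^ 'b"
  proof -
    have "cinner (axis i u) x = (\<Sum>j\<in>UNIV. if j = i then cinner u (x $ i) else 0)"
      unfolding cinner_vec_def by (intro sum.cong) (auto simp: axis_def z)
    then show ?thesis by simp
  qed
  fix r :: real and a b :: complex and x y w u v :: "'a ^ 'b"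
  show "scaleC (complex_of_real r) x = r *\<^sub>R x"
    by (simp add: scaleC_vec_def vec_eq_iff scaleC_of_real)
  show "scaleC (a + b) x = scaleC a x + scaleC b x"
    by (simp add: scaleC_vec_def vec_eq_iff scaleC_add_left)
  show "scaleC a (x + y) = scaleC a x + scaleC a y"
    by (simp add: scaleC_vec_def vec_eq_iff scaleC_add_right)
  show "scaleC a (scaleC b x) = scaleC (a * b) x"
    by (simp add: scaleC_vec_def vec_eq_iff scaleC_scaleC)
  show "cinner x y = cnj (cinner y x)"
    unfolding cinner_vec_def cnj_sum by (intro sum.cong refl cinner_commute)
  show "cinner x (y + w) = cinner x y + cinner x w"
    by (simp add: cinner_vec_def cinner_add_right sum.distrib)
  show "cinner x (scaleC a y) = a * cinner x y"
    by (simp add: cinner_vec_def scaleC_vec_def cinner_scaleC_right sum_distrib_left)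
  show "Re (cinner x y) = inner x y"
    by (simp add: cinner_vec_def inner_vec_def Re_cinner)
  show "finite (CBasis :: ('a ^ 'b) set)"
    by (simp add: CBasis_vec_def finite_CBasis)
  show "cinner u v = (if u = v then 1 else 0)" if "u \<in> CBasis" "v \<in> CBasis"
  proof -
    obtain i j s t where st: "s \<in> CBasis" "t \<in> CBasis" "u = axis i s" "v = axis j t"
      using \<open>u \<in> CBasis\<close> \<open>v \<in> CBasis\<close> by (auto simp: CBasis_vec_def)
    have "s \<noteq> 0" "t \<noteq> 0"
      using cinner_CBasis[of s s] cinner_CBasis[of t t] st(1,2) z by auto
    then have eq: "u = v \<longleftrightarrow> i = j \<and> s = t"
      unfolding st axis_eq_axis by blast
    have "cinner u v = cinner s (axis j t $ i)"
      unfolding st by (rule ax)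
    then show ?thesis
      unfolding eq using st(1,2) by (auto simp: axis_def cinner_CBasis z)
  qed
  have "(\<forall>u\<in>CBasis. cinner u x = 0) \<longleftrightarrow> (\<forall>i. \<forall>u\<in>CBasis. cinner u (x $ i) = 0)"
    by (auto simp: CBasis_vec_def ax)
  also have "\<dots> \<longleftrightarrow> x = 0"
    by (simp add: cinner_all_zero_iff vec_eq_iff)
  finally show "(\<forall>u\<in>CBasis. cinner u x = 0) \<longleftrightarrow> x = 0" .
qed

end

text \<open>Elements of $\mathcal{L}(H)$ are functions; sums and differences of operators, and of
  operator-valued kernels, are the pointwise ones.\<close>

definition bounded_clinear :: "('h::complex_euclidean \<Rightarrow> 'h) \<Rightarrow> bool"
  where "bounded_clinear T \<longleftrightarrow> Vector_Spaces.linear scaleC scaleC T \<and> bounded_linear T"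

definition cadjoint :: "('h::complex_euclidean \<Rightarrow> 'h) \<Rightarrow> ('h \<Rightarrow> 'h)"
  where "cadjoint T = (SOME S. \<forall>x y. cinner (S x) y = cinner x (T y))"

definition ctrace :: "('h::complex_euclidean \<Rightarrow> 'h) \<Rightarrow> complex"
  where "ctrace T = (\<Sum>b\<in>CBasis. cinner b (T b))"

text \<open>The free semigroup on $\{1,\dots,d\}$ is the set of words over this alphabet, with
  concatenation \<^term>\<open>(@)\<close> and neutral element \<^term>\<open>[]\<close>.\<close>

abbreviation free_semigroup :: "nat \<Rightarrow> nat list set"
  where "free_semigroup d \<equiv> lists {1..d}"

type_synonym 'h kernel = "nat list \<Rightarrow> nat list \<Rightarrow> 'h \<Rightarrow> 'h"

primrec word_op :: "(nat \<Rightarrow> 'h \<Rightarrow> 'h) \<Rightarrow> nat list \<Rightarrow> 'h \<Rightarrow> 'h"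
  where
    "word_op A [] = id"
  | "word_op A (i # \<alpha>) = A i \<circ> word_op A \<alpha>"

definition random_operator :: "'w measure \<Rightarrow> ('w \<Rightarrow> 'h::complex_euclidean \<Rightarrow> 'h) \<Rightarrow> bool"
  where "random_operator M T \<longleftrightarrow>
    (\<forall>\<omega>\<in>space M. bounded_clinear (T \<omega>)) \<and> (\<forall>x. (\<lambda>\<omega>. T \<omega> x) \<in> borel_measurable M)"

text \<open>The operator-valued expectation is taken in the strong sense, as a Bochner integral after
  evaluation at a vector.\<close>

definition moment_kernel :: "'w measure \<Rightarrow> nat \<Rightarrow> 'h::complex_euclidean kernel \<Rightarrow> bool"
  where "moment_kernel M d K \<longleftrightarrow> prob_space M \<and>
    (\<exists>A :: nat \<Rightarrow> 'w \<Rightarrow> 'h \<Rightarrow> 'h.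
      (\<forall>i\<in>{1..d}. random_operator M (A i)) \<and>
      (\<forall>\<alpha>\<in>free_semigroup d. integrable M (\<lambda>\<omega>. (onorm (word_op (\<lambda>i. A i \<omega>) \<alpha>))\<^sup>2)) \<and>
      (\<forall>\<alpha>\<in>free_semigroup d. \<forall>\<beta>\<in>free_semigroup d. \<forall>v.
        K \<alpha> \<beta> v =
          (\<integral>\<omega>. word_op (\<lambda>i. A i \<omega>) \<alpha> (cadjoint (word_op (\<lambda>i. A i \<omega>) \<beta>) v) \<partial>M)))"

text \<open>Below, \<^term>\<open>0 \<le> z\<close> for complex \<^term>\<open>z\<close> says that \<^term>\<open>z\<close> is real and nonnegative.\<close>

definition pos_def_kernel :: "nat \<Rightarrow> 'h::complex_euclidean kernel \<Rightarrow> bool"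
  where "pos_def_kernel d K \<longleftrightarrow>
    (\<forall>(m::nat) \<alpha> u. (\<forall>j<m. \<alpha> j \<in> free_semigroup d) \<longrightarrow>
      0 \<le> (\<Sum>i<m. \<Sum>j<m. cinner (u i) (K (\<alpha> i) (\<alpha> j) (u j))))"

definition free_shift :: "nat \<Rightarrow> 'h::complex_euclidean kernel \<Rightarrow> 'h kernel"
  where "free_shift d K = (\<lambda>\<alpha> \<beta>. \<Sum>i=1..d. K (\<alpha> @ [i]) (\<beta> @ [i]))"

definition curvature :: "nat \<Rightarrow> 'h::complex_euclidean kernel \<Rightarrow> complex"
  where "curvature d K = lim (\<lambda>N. ctrace ((free_shift d ^^ N) K [] []))"

end

theory Submission
  imports Defs
begin

text \<open>
  Since \<open>\<Sigma>\<close> is additive, \<open>\<Sigma>\<^sup>n K\<^sup>(\<^sup>1\<^sup>) = \<Sigma>\<^sup>n K - \<Sigma>\<^sup>n\<^sup>+\<^sup>1 K\<close>, so the sum of these kernels telescopes.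
  Nonnegativity on the diagonal is preserved by \<open>\<Sigma>\<close>. It holds for \<open>K\<close>, because
  \<open>K(\<alpha>,\<alpha>) = E[A\<^sup>\<alpha>(A\<^sup>\<alpha>)\<^sup>*]\<close>, and for \<open>K\<^sup>(\<^sup>1\<^sup>)\<close>, by testing positive definiteness on families with one
  member. Hence the traces of \<open>(\<Sigma>\<^sup>n K\<^sup>(\<^sup>1\<^sup>))(\<emptyset>,\<emptyset>)\<close> are nonnegative and their partial sums
  \<open>tr(I) - tr((\<Sigma>\<^sup>N K)(\<emptyset>,\<emptyset>))\<close> are bounded by \<open>tr(I)\<close>.
\<close>

lemma cinner_add_left: "cinner (x + y) z = cinner x z + cinner y (z::'h::complex_euclidean)"
  by (metis cinner_add_right cinner_commute complex_cnj_add)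

lemma cinner_scaleC_left: "cinner (scaleC a x) y = cnj a * cinner x (y::'h::complex_euclidean)"
  by (metis cinner_commute cinner_scaleC_right complex_cnj_mult)

lemma cinner_zero_right [simp]: "cinner x (0::'h::complex_euclidean) = 0"
  using cinner_add_right[of x 0 0] by simp

lemma cinner_zero_left [simp]: "cinner (0::'h::complex_euclidean) x = 0"
  using cinner_add_left[of 0 0 x] by simp

lemma cinner_sum_right:
  "cinner x (\<Sum>i\<in>I. f i) = (\<Sum>i\<in>I. cinner x (f i :: 'h::complex_euclidean))"
  by (induction I rule: infinite_finite_induct) (auto simp: cinner_add_right)

lemma cinner_sum_left:
  "cinner (\<Sum>i\<in>I. f i) x = (\<Sum>i\<in>I. cinner (f i :: 'h::complex_euclidean) x)"
  by (induction I rule: infinite_finite_induct) (auto simp: cinner_add_left)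

lemma cinner_diff_right:
  "cinner x (y - z) = cinner x y - cinner x (z::'h::complex_euclidean)"
  using cinner_add_right[of x "y - z" z] by simp

lemma cinner_self_nonneg: "0 \<le> cinner x (x::'h::complex_euclidean)"
proof -
  have "Im (cinner x x) = 0"
    using arg_cong[OF cinner_commute[of x x], of Im] by simp
  then show ?thesis
    by (simp add: less_eq_complex_def Re_cinner)
qed

text \<open>Antilinearity in the first argument turns \<open>scaleC \<i> x\<close> into a factor
  \<open>-\<i>\<close>, whose effect is to move the imaginary part of \<open>cinner x y\<close> into
  the real part. Boundedness of \<open>cinner x\<close> thereby reduces to that of
  \<open>inner\<close>.\<close>

lemma cinner_eq_inner:
  "cinner x y = complex_of_real (inner x y) + \<i> * complex_of_real (inner (scaleC \<i> x) y)"
  for x y :: "'h::complex_euclidean"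
  using cinner_scaleC_left[of \<i> x y]
  by (simp add: complex_eq_iff flip: Re_cinner)

lemma bounded_linear_cinner_right: "bounded_linear (cinner (x::'h::complex_euclidean))"
proof -
  have "bounded_linear (\<lambda>y. complex_of_real (inner x y) + \<i> * complex_of_real (inner (scaleC \<i> x) y))"
    by (intro bounded_linear_add bounded_linear_const_mult
        bounded_linear_compose[OF bounded_linear_of_real] bounded_linear_inner_right)
  then show ?thesis
    by (simp flip: cinner_eq_inner)
qed

text \<open>The difference of the two sides is orthogonal to every basis vector, hence zero by
  \<open>cinner_all_zero_iff\<close>.\<close>

lemma CBasis_expansion: "(\<Sum>b\<in>CBasis. scaleC (cinner b x) b) = (x::'h::complex_euclidean)"
proof -
  have "cinner u (x - (\<Sum>b\<in>CBasis. scaleC (cinner b x) b)) = 0" if "u \<in> CBasis" for u :: 'h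
  proof -
    have "cinner u (\<Sum>b\<in>CBasis. scaleC (cinner b x) b)
        = (\<Sum>b\<in>CBasis. if u = b then cinner b x else 0)"
      unfolding cinner_sum_right
      by (intro sum.cong) (auto simp: cinner_scaleC_right cinner_CBasis that)
    also have "\<dots> = cinner u x"
      using that by (simp add: finite_CBasis)
    finally show ?thesis by (simp add: cinner_diff_right)
  qed
  then show ?thesis
    using cinner_all_zero_iff[of "x - (\<Sum>b\<in>CBasis. scaleC (cinner b x) b)"] by simp
qed

lemma clinear_expansion:
  fixes T :: "'h::complex_euclidean \<Rightarrow> 'h"
  assumes "Vector_Spaces.linear scaleC scaleC T"
  shows "T y = (\<Sum>b\<in>CBasis. scaleC (cinner b y) (T b))"
proof -
  interpret Vector_Spaces.linear scaleC scaleC T by fact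
  show ?thesis
    by (subst CBasis_expansion[of y, symmetric]) (simp only: sum scale)
qed

text \<open>As \<open>cadjoint\<close> is a \<open>SOME\<close> choice, its defining property holds
  once some adjoint is exhibited.\<close>

lemma cinner_cadjoint:
  fixes T :: "'h::complex_euclidean \<Rightarrow> 'h"
  assumes "Vector_Spaces.linear scaleC scaleC T"
  shows "cinner (cadjoint T x) y = cinner x (T y)"
proof -
  \<comment> \<open>An adjoint must have \<open>cinner (T b) x\<close> as its coefficient at
    \<open>b\<close>, which dictates this expansion.\<close>
  define S where "S x = (\<Sum>b\<in>CBasis. scaleC (cinner (T b) x) b)" for x
  have "cinner (S x) y = cinner x (T y)" for x y
  proof -
    have "cinner (S x) y = (\<Sum>b\<in>CBasis. cinner x (T b) * cinner b y)"
      unfolding S_def cinner_sum_left cinner_scaleC_left cinner_commute[of _ "T _"]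
      by (simp add: cinner_commute[of x])
    also have "\<dots> = cinner x (T y)"
      by (simp add: clinear_expansion[OF assms, of y] cinner_sum_right cinner_scaleC_right mult.commute)
    finally show ?thesis .
  qed
  then have "\<exists>S. \<forall>x y. cinner (S x) y = cinner x (T y)" by blast
  from someI_ex[OF this] show ?thesis
    unfolding cadjoint_def by blast
qed

lemma vector_space_scaleC: "vector_space (scaleC :: complex \<Rightarrow> 'h \<Rightarrow> 'h::complex_euclidean)"
  using scaleC_of_real[of 1]
  by unfold_locales (auto simp: scaleC_add_left scaleC_add_right scaleC_scaleC)

text \<open>Linearity is asked only of the letters that occur, because a moment kernel constrains
  \<open>A i\<close> only for \<open>i\<close> in \<open>{1..d}\<close>.\<close>

lemma linear_word_op:
  fixes A :: "nat \<Rightarrow> 'h::complex_euclidean \<Rightarrow> 'h"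
  assumes "\<And>i. i \<in> set \<alpha> \<Longrightarrow> Vector_Spaces.linear scaleC scaleC (A i)"
  shows "Vector_Spaces.linear scaleC scaleC (word_op A \<alpha>)"
  using assms
proof (induction \<alpha>)
  case Nil
  show ?case
    using vector_space.linear_id[OF vector_space_scaleC] by (simp add: id_def)
next
  case (Cons i \<alpha>)
  then show ?case
    by (auto intro: Vector_Spaces.linear_compose simp del: o_apply)
qed

text \<open>With \<open>T\<close> the word operator at a sample point, moving \<open>T\<close>
  across the inner product gives the squared norm of \<open>cadjoint T v\<close>; the bounded
  functional \<open>cinner v\<close> then passes through the integral.\<close>

lemma moment_kernel_diag_nonneg:
  fixes K :: "'h::complex_euclidean kernel"
  assumes "moment_kernel M d K" and \<alpha>: "\<alpha> \<in> free_semigroup d"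
  shows "0 \<le> cinner v (K \<alpha> \<alpha> v)"
proof -
  obtain A where A: "\<And>i. i \<in> {1..d} \<Longrightarrow> random_operator M (A i)"
    and K: "K \<alpha> \<alpha> v =
      (\<integral>\<omega>. word_op (\<lambda>i. A i \<omega>) \<alpha> (cadjoint (word_op (\<lambda>i. A i \<omega>) \<alpha>) v) \<partial>M)"
    using assms unfolding moment_kernel_def by blast
  define f where "f \<omega> = word_op (\<lambda>i. A i \<omega>) \<alpha> (cadjoint (word_op (\<lambda>i. A i \<omega>) \<alpha>) v)" for \<omega>
  have f: "0 \<le> cinner v (f \<omega>)" if "\<omega> \<in> space M" for \<omega>
  proof -
    have "Vector_Spaces.linear scaleC scaleC (word_op (\<lambda>i. A i \<omega>) \<alpha>)"
      using A \<alpha> that by (intro linear_word_op) (auto simp: random_operator_def bounded_clinear_def)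
    then show ?thesis
      unfolding f_def by (simp add: cinner_self_nonneg flip: cinner_cadjoint)
  qed
  show ?thesis
  proof (cases "integrable M f")
    case True
    have "cinner v (K \<alpha> \<alpha> v) = (\<integral>\<omega>. cinner v (f \<omega>) \<partial>M)"
      unfolding K f_def[symmetric]
      by (rule integral_bounded_linear[OF bounded_linear_cinner_right True, symmetric])
    \<comment> \<open>A nonnegative complex number equals its real part, so the integral becomes
      that of a nonnegative real function.\<close>
    also have "\<dots> = (\<integral>\<omega>. complex_of_real (Re (cinner v (f \<omega>))) \<partial>M)"
      using f by (intro Bochner_Integration.integral_cong)
        (auto simp: less_eq_complex_def complex_eq_iff)
    also have "\<dots> = complex_of_real (\<integral>\<omega>. Re (cinner v (f \<omega>)) \<partial>M)"
      by (rule integral_complex_of_real)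
    also have "0 \<le> \<dots>"
      using f by (auto intro!: integral_nonneg_AE AE_I2 simp: less_eq_complex_def)
    finally show ?thesis .
  next
    \<comment> \<open>The Bochner integral of a nonintegrable function is 0 by convention, so the
      inner product is 0 here.\<close>
    case False
    then show ?thesis
      unfolding K f_def[symmetric] by (simp add: not_integrable_integral_eq)
  qed
qed

lemma pos_def_kernel_diag_nonneg:
  fixes K :: "'h::complex_euclidean kernel"
  assumes "pos_def_kernel d K" and "\<alpha> \<in> free_semigroup d"
  shows "0 \<le> cinner v (K \<alpha> \<alpha> v)"
  using assms(1)[unfolded pos_def_kernel_def, rule_format, of 1 "\<lambda>_. \<alpha>" "\<lambda>_. v"] assms(2)
  by simp

lemma sum_fun_apply: "(\<Sum>i\<in>I. f i) x = (\<Sum>i\<in>I. f i x)"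
  by (induction I rule: infinite_finite_induct) auto

text \<open>A shift turns a diagonal entry into a sum of diagonal entries at longer words, so the
  induction needs all words even to reach \<open>[]\<close>.\<close>

lemma free_shift_pow_diag_nonneg:
  fixes K :: "'h::complex_euclidean kernel"
  assumes "\<And>\<alpha> v. \<alpha> \<in> free_semigroup d \<Longrightarrow> 0 \<le> cinner v (K \<alpha> \<alpha> v)"
    and "\<alpha> \<in> free_semigroup d"
  shows "0 \<le> cinner v ((free_shift d ^^ n) K \<alpha> \<alpha> v)"
  using assms(2)
proof (induction n arbitrary: \<alpha>)
  case 0
  then show ?case using assms(1) by simp
next
  case (Suc n)
  have "(free_shift d ^^ Suc n) K \<alpha> \<alpha> v = (\<Sum>i=1..d. (free_shift d ^^ n) K (\<alpha> @ [i]) (\<alpha> @ [i]) v)"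
    by (simp add: free_shift_def sum_fun_apply)
  moreover have "\<alpha> @ [i] \<in> free_semigroup d" if "i \<in> {1..d}" for i
    using Suc.prems that by simp
  ultimately show ?case
    by (simp only: cinner_sum_right) (intro sum_nonneg Suc.IH)
qed

lemma ctrace_nonneg:
  assumes "\<And>v. 0 \<le> cinner v (T v)"
  shows "0 \<le> ctrace T"
  unfolding ctrace_def using assms by (intro sum_nonneg) auto

lemma ctrace_diff: "ctrace (S - T) = ctrace S - ctrace T"
  by (simp add: ctrace_def cinner_diff_right sum_subtractf)

lemma free_shift_diff: "free_shift d (K - L) = free_shift d K - free_shift d L"
  by (simp add: free_shift_def fun_eq_iff sum_subtractf)

lemma free_shift_pow_diff:
  "(free_shift d ^^ n) (K - L) = (free_shift d ^^ n) K - (free_shift d ^^ n) L"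
  by (induction n) (simp_all only: funpow.simps id_apply o_apply free_shift_diff)

text \<open>All terms are real, so bounded monotone convergence applies to the real parts and is
  carried back along \<open>complex_of_real\<close>.\<close>

lemma decreasing_telescope:
  fixes t a :: "nat \<Rightarrow> complex"
  assumes a: "\<And>n. a n = t n - t (Suc n)" and "\<And>n. 0 \<le> a n" and "\<And>n. 0 \<le> t n"
  shows "summable a" and "t \<longlonglongrightarrow> t 0 - suminf a" and "suminf a \<in> {0..t 0}"
proof -
  have partial: "(\<Sum>n<N. a n) = t 0 - t N" for N
    unfolding a by (rule sum_lessThan_telescope')
  have a_real: "a n = complex_of_real (Re (a n))" and t_real: "t n = complex_of_real (Re (t n))" for n
    using assms(2,3)[of n] by (simp_all add: less_eq_complex_def complex_eq_iff)
  have nonneg: "0 \<le> Re (a n)" "0 \<le> Re (t n)" for n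
    using assms(2,3)[of n] by (simp_all add: less_eq_complex_def)
  have bound: "(\<Sum>n<N. Re (a n)) \<le> Re (t 0)" for N
    using partial[of N] nonneg(2)[of N] by (simp flip: Re_sum)
  have summ: "summable (\<lambda>n. Re (a n))"
    by (rule summableI_nonneg_bounded[OF nonneg(1) bound])
  have sums: "a sums complex_of_real (\<Sum>n. Re (a n))"
    using sums_of_real[OF summable_sums[OF summ], where ?'a = complex] a_real by simp
  then show "summable a"
    by (rule sums_summable)
  have suminf: "suminf a = complex_of_real (\<Sum>n. Re (a n))"
    using sums by (rule sums_unique[symmetric])
  \<comment> \<open>By \<open>partial\<close>, this sequence is \<open>t\<close> itself.\<close>
  have "(\<lambda>N. t 0 - (\<Sum>n<N. a n)) \<longlonglongrightarrow> t 0 - suminf a"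
    by (intro tendsto_diff tendsto_const summable_LIMSEQ \<open>summable a\<close>)
  then show "t \<longlonglongrightarrow> t 0 - suminf a"
    unfolding partial by simp
  have "0 \<le> (\<Sum>n. Re (a n))" "(\<Sum>n. Re (a n)) \<le> Re (t 0)"
    using nonneg(1) by (auto intro: suminf_nonneg suminf_le_const summ bound)
  then show "suminf a \<in> {0..t 0}"
    \<comment> \<open>The complex order also compares imaginary parts, so \<open>t 0\<close> has to
      be known to be real.\<close>
    unfolding suminf using t_real[of 0]
    by (auto simp: less_eq_complex_def complex_eq_iff)
qed

theorem theorem6p3:
  fixes d :: nat and M :: "'w measure" and K K1 :: "'h::complex_euclidean kernel"
  assumes "moment_kernel M d K"
    and "K [] [] = id"
    and "K1 = K - free_shift d K"
    and "pos_def_kernel d K1"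
  shows "(\<forall>N\<ge>1. \<forall>\<alpha>\<in>free_semigroup d. \<forall>\<beta>\<in>free_semigroup d.
            (K - (free_shift d ^^ N) K) \<alpha> \<beta> = (\<Sum>n<N. (free_shift d ^^ n) K1) \<alpha> \<beta>)
       \<and> convergent (\<lambda>N. ctrace ((free_shift d ^^ N) K [] []))
       \<and> summable (\<lambda>n. ctrace ((free_shift d ^^ n) K1 [] []))
       \<and> curvature d K = ctrace (id :: 'h \<Rightarrow> 'h) - (\<Sum>n. ctrace ((free_shift d ^^ n) K1 [] []))
       \<and> (\<Sum>n. ctrace ((free_shift d ^^ n) K1 [] [])) \<in> {0..ctrace (id :: 'h \<Rightarrow> 'h)}"
proof -
  define t where "t N = ctrace ((free_shift d ^^ N) K [] [])" for N
  define a where "a n = ctrace ((free_shift d ^^ n) K1 [] [])" for n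
  \<comment> \<open>Powers of the shift are additive, and \<open>funpow_swap1\<close> merges the
    inner shift into the power.\<close>
  have K1: "(free_shift d ^^ n) K1 = (free_shift d ^^ n) K - (free_shift d ^^ Suc n) K" for n
    unfolding assms(3) free_shift_pow_diff by (simp add: funpow_swap1)
  have telescope: "K - (free_shift d ^^ N) K = (\<Sum>n<N. (free_shift d ^^ n) K1)" for N
    unfolding K1 by (subst sum_lessThan_telescope') simp
  have "a n = t n - t (Suc n)" for n
    unfolding a_def t_def K1 by (simp add: ctrace_diff)
  moreover have "0 \<le> t n" for n
    unfolding t_def
    by (intro ctrace_nonneg free_shift_pow_diag_nonneg moment_kernel_diag_nonneg[OF assms(1)]) auto
  moreover have "0 \<le> a n" for n
    unfolding a_def
    by (intro ctrace_nonneg free_shift_pow_diag_nonneg pos_def_kernel_diag_nonneg[OF assms(4)]) auto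
  ultimately have lims: "summable a" "t \<longlonglongrightarrow> t 0 - suminf a" "suminf a \<in> {0..t 0}"
    using decreasing_telescope[of a t] by blast+
  have t0: "t 0 = ctrace (id :: 'h \<Rightarrow> 'h)"
    by (simp add: t_def assms(2))
  \<comment> \<open>\<open>curvature\<close> is a \<open>lim\<close>, so its value is read off from
    the established convergence of \<open>t\<close>.\<close>
  have "curvature d K = t 0 - suminf a"
    unfolding curvature_def t_def[symmetric] by (rule limI[OF lims(2)])
  moreover have "convergent t"
    using lims(2) by (rule convergentI)
  ultimately show ?thesis
    using lims(1,3) unfolding t_def[symmetric] a_def[symmetric] t0 by (simp add: telescope)
qed

end
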